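(* Let $n\ge 4$ and let $SD_{2^n}=\langle r,s \mid r^{2^{n-1}}=s^2=1,\ srs=r^{2^{n-2}-1}\rangle$ be the semidihedral group of order $2^n$. Then \[\gamma(\Gamma_c(SD_{2^n}))=\gamma(K_{2^{n-1}-2}).\]
   Context: For a non-abelian group $G$ with center $Z(G)$, the commuting graph $\Gamma_c(G)$ is the simple undirected graph with vertex set $G\setminus Z(G)$, in which two distinct vertices $x,y$ are adjacent if and only if $xy=yx$. The genus $\gamma(\Gamma)$ of a graph $\Gamma$ is the smallest non-negative integer $n$ such that $\Gamma$ can be embedded on the surface obtained by attaching $n$ handles to a sphere. $K_m$ denotes the complete graph on $m$ vertices. *)

theory Defs
  imports "HOL-Analysis.Analysis" "HOL-Algebra.Group" "Graph_Theory.Kuratowski"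
begin

text \<open>A letter \<open>(a, True)\<close> stands for the generator \<open>a\<close>, and \<open>(a, False)\<close> for its formal inverse;
  a relation \<open>u = w\<close> is given as the pair \<open>(u, w)\<close>.\<close>

type_synonym 'a word = "('a \<times> bool) list"

inductive word_eq :: "('a word \<times> 'a word) set \<Rightarrow> 'a word \<Rightarrow> 'a word \<Rightarrow> bool"
  for rels :: "('a word \<times> 'a word) set" where
  refl: "word_eq rels u u"
| sym: "word_eq rels u w \<Longrightarrow> word_eq rels w u"
| trans: "word_eq rels u v \<Longrightarrow> word_eq rels v w \<Longrightarrow> word_eq rels u w"
| cancel: "word_eq rels (p @ [(a, b), (a, \<not> b)] @ q) (p @ q)"
| relation: "(u, w) \<in> rels \<Longrightarrow> word_eq rels (p @ u @ q) (p @ w @ q)"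

definition word_class :: "('a word \<times> 'a word) set \<Rightarrow> 'a word \<Rightarrow> 'a word set" where
  "word_class rels u = {w. word_eq rels u w}"

definition presented_group :: "('a word \<times> 'a word) set \<Rightarrow> 'a word set monoid" where
  "presented_group rels =
    \<lparr>carrier = range (word_class rels),
     monoid.mult = (\<lambda>A B. {w. \<exists>u\<in>A. \<exists>v\<in>B. word_eq rels (u @ v) w}),
     one = word_class rels []\<rparr>"

lemma word_eq_append:
  assumes "word_eq rels u u'" "word_eq rels v v'"
  shows "word_eq rels (u @ v) (u' @ v')"
proof -
  have right: "word_eq rels (x @ z) (y @ z)" if "word_eq rels x y" for x y z
    using that
  proof induction
    case (cancel p a b q)
    show ?case using word_eq.cancel[of rels p a b "q @ z"] by simp
  next
    case (relation u w p q)
    then show ?case using word_eq.relation[of u w rels p "q @ z"] by simp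
  qed (blast intro: word_eq.intros)+
  have left: "word_eq rels (z @ x) (z @ y)" if "word_eq rels x y" for x y z
    using that
  proof induction
    case (cancel p a b q)
    show ?case using word_eq.cancel[of rels "z @ p" a b q] by simp
  next
    case (relation u w p q)
    then show ?case using word_eq.relation[of u w rels "z @ p" q] by simp
  qed (blast intro: word_eq.intros)+
  show ?thesis using right[OF assms(1)] left[OF assms(2)] by (blast intro: word_eq.trans)
qed

lemma word_class_eq_iff: "word_class rels u = word_class rels w \<longleftrightarrow> word_eq rels u w"
  unfolding word_class_def by (blast intro: word_eq.refl word_eq.sym word_eq.trans)

lemma presented_group_mult:
  "word_class rels u \<otimes>\<^bsub>presented_group rels\<^esub> word_class rels v = word_class rels (u @ v)"
proof -
  have "(\<exists>u'. word_eq rels u u' \<and> (\<exists>v'. word_eq rels v v' \<and> word_eq rels (u' @ v') w))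
      \<longleftrightarrow> word_eq rels (u @ v) w" for w
    by (meson word_eq_append word_eq.refl word_eq.trans)
  then show ?thesis by (auto simp: presented_group_def word_class_def)
qed

lemma word_eq_inverse: "word_eq rels (map (\<lambda>(a, b). (a, \<not> b)) (rev u) @ u) []"
proof (induction u)
  case Nil
  show ?case by (simp add: word_eq.refl)
next
  case (Cons l u)
  obtain a b where l: "l = (a, b)" by fastforce
  let ?v = "map (\<lambda>(a, b). (a, \<not> b)) (rev u)"
  have "word_eq rels (?v @ [(a, \<not> b), (a, \<not> \<not> b)] @ u) (?v @ u)"
    by (rule word_eq.cancel)
  with Cons l show ?case by (auto intro: word_eq.trans)
qed

lemma group_presented_group: "group (presented_group rels)"
proof (rule groupI)
  fix x assume "x \<in> carrier (presented_group rels)"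
  then obtain u where u: "x = word_class rels u" by (auto simp: presented_group_def)
  let ?y = "word_class rels (map (\<lambda>(a, b). (a, \<not> b)) (rev u))"
  have "?y \<otimes>\<^bsub>presented_group rels\<^esub> x = word_class rels []"
    unfolding u presented_group_mult word_class_eq_iff by (rule word_eq_inverse)
  moreover have "?y \<in> carrier (presented_group rels)"
    and "\<one>\<^bsub>presented_group rels\<^esub> = word_class rels []"
    by (simp_all add: presented_group_def)
  ultimately show "\<exists>y\<in>carrier (presented_group rels).
      y \<otimes>\<^bsub>presented_group rels\<^esub> x = \<one>\<^bsub>presented_group rels\<^esub>"
    by metis
next
  have carr: "carrier (presented_group rels) = range (word_class rels)"
    and one: "\<one>\<^bsub>presented_group rels\<^esub> = word_class rels []"
    by (simp_all add: presented_group_def)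
  show "\<one>\<^bsub>presented_group rels\<^esub> \<in> carrier (presented_group rels)"
    by (simp add: carr one)
  fix x y assume x: "x \<in> carrier (presented_group rels)" and y: "y \<in> carrier (presented_group rels)"
  show "x \<otimes>\<^bsub>presented_group rels\<^esub> y \<in> carrier (presented_group rels)"
    using x y by (auto simp: carr presented_group_mult)
  show "\<one>\<^bsub>presented_group rels\<^esub> \<otimes>\<^bsub>presented_group rels\<^esub> x = x"
    using x by (auto simp: carr one presented_group_mult)
  fix z assume "z \<in> carrier (presented_group rels)"
  with x y show "x \<otimes>\<^bsub>presented_group rels\<^esub> y \<otimes>\<^bsub>presented_group rels\<^esub> z
      = x \<otimes>\<^bsub>presented_group rels\<^esub> (y \<otimes>\<^bsub>presented_group rels\<^esub> z)"
    by (auto simp: carr presented_group_mult)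
qed

datatype sd_gen = Gen_r | Gen_s

definition semidihedral :: "nat \<Rightarrow> sd_gen word set monoid" where
  "semidihedral n =
    (let r = (Gen_r, True); s = (Gen_s, True)
     in presented_group
         {(replicate (2 ^ (n - 1)) r, []),
          ([s, s], []),
          ([s, r, s], replicate (2 ^ (n - 2) - 1) r)})"

text \<open>As in the graph library, a simple undirected graph is a loop-free symmetric digraph without
  multiple arcs: an edge is a pair of opposite arcs.\<close>

definition group_center :: "('a, 'm) monoid_scheme \<Rightarrow> 'a set" where
  "group_center G = {z \<in> carrier G. \<forall>x\<in>carrier G. z \<otimes>\<^bsub>G\<^esub> x = x \<otimes>\<^bsub>G\<^esub> z}"

definition commuting_graph :: "('a, 'm) monoid_scheme \<Rightarrow> ('a, 'a \<times> 'a) pre_digraph" where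
  "commuting_graph G =
    \<lparr>verts = carrier G - group_center G,
     arcs = {(x, y). x \<in> carrier G - group_center G \<and> y \<in> carrier G - group_center G
                      \<and> x \<noteq> y \<and> x \<otimes>\<^bsub>G\<^esub> y = y \<otimes>\<^bsub>G\<^esub> x},
     tail = fst, head = snd\<rparr>"

lemma graph_commuting_graph:
  assumes "finite (carrier G)"
  shows "graph (commuting_graph G)"
proof unfold_locales
  show "finite (verts (commuting_graph G))"
    using assms by (simp add: commuting_graph_def)
  have "arcs (commuting_graph G) \<subseteq> carrier G \<times> carrier G"
    by (auto simp: commuting_graph_def)
  with assms show "finite (arcs (commuting_graph G))"
    by (meson finite_SigmaI finite_subset)
  show "symmetric (commuting_graph G)"
    unfolding symmetric_def
    by (rule symI) (auto simp: commuting_graph_def arcs_ends_def arc_to_ends_def image_iff)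
qed (auto simp: commuting_graph_def arc_to_ends_def)

text \<open>The sphere with \<open>g\<close> handles, as a subset of \<open>complex \<times> real\<close>, i.e. of Euclidean 3-space.
  For \<open>i < g\<close>, the open solid cylinder of radius 1 about the vertical line through \<open>3 * i\<close> cuts
  two opposite open discs out of a sphere of radius \<open>3 * g + 1\<close>; the part of the cylinder's lateral
  surface inside the ball is a tube joining the two boundary circles. These \<open>2 * g\<close> discs
  have disjoint closures, and the tubes are disjoint. (Being embedded in 3-space, the result is
  orientable, so that these are handles and not Klein handles.)\<close>

definition handle_disc :: "nat \<Rightarrow> (complex \<times> real) set" where
  "handle_disc i = {(w, z). cmod (w - of_nat (3 * i)) < 1}"

definition handle_tube :: "nat \<Rightarrow> nat \<Rightarrow> (complex \<times> real) set" where
  "handle_tube g i = {(w, z) \<in> cball 0 (3 * real g + 1). cmod (w - of_nat (3 * i)) = 1}"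

definition sphere_with_handles :: "nat \<Rightarrow> (complex \<times> real) set" where
  "sphere_with_handles g =
    (sphere 0 (3 * real g + 1) - (\<Union>i<g. handle_disc i)) \<union> (\<Union>i<g. handle_tube g i)"

definition edges :: "('a, 'b) pre_digraph \<Rightarrow> 'a set set" where
  "edges \<Gamma> = {{u, v} | u v. (u, v) \<in> arcs_ends \<Gamma>}"

text \<open>For a finite simple graph: vertices go to distinct points and edges to simple arcs that join
  the images of their end vertices, and that meet the images of vertices and each other only in the
  images of common vertices.\<close>

definition embeddable_in :: "('a, 'b) pre_digraph \<Rightarrow> 'c::topological_space set \<Rightarrow> bool" where
  "embeddable_in \<Gamma> S \<longleftrightarrow>
    (\<exists>(p :: 'a \<Rightarrow> 'c) (\<gamma> :: 'a set \<Rightarrow> real \<Rightarrow> 'c).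
       inj_on p (verts \<Gamma>) \<and> p ` verts \<Gamma> \<subseteq> S \<and>
       (\<forall>e\<in>edges \<Gamma>. arc (\<gamma> e) \<and> path_image (\<gamma> e) \<subseteq> S \<and>
          {pathstart (\<gamma> e), pathfinish (\<gamma> e)} = p ` e \<and>
          path_image (\<gamma> e) \<inter> p ` verts \<Gamma> = p ` e) \<and>
       (\<forall>e\<in>edges \<Gamma>. \<forall>f\<in>edges \<Gamma>. e \<noteq> f \<longrightarrow>
          path_image (\<gamma> e) \<inter> path_image (\<gamma> f) = p ` (e \<inter> f)))"

definition genus :: "('a, 'b) pre_digraph \<Rightarrow> nat" where
  "genus \<Gamma> = (LEAST g. embeddable_in \<Gamma> (sphere_with_handles g))"

end

theory Submission
  imports Defs "HOL-Number_Theory.Cong"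
begin

text \<open>Write \<open>m = 2 ^ (n - 2)\<close>. Non-central rotations commute with each other but with no reflection,
  and two reflections \<open>r ^ i * s\<close> and \<open>r ^ j * s\<close> commute if and only if \<open>i\<close> and \<open>j\<close> are congruent
  modulo \<open>m\<close>; so the commuting graph is the disjoint union of a clique on \<open>2 * m - 2\<close> vertices and
  \<open>m\<close> isolated edges. Isolated edges do not affect the genus: by invariance of dimension, finitely
  many arcs cannot cover an open patch of a surface, and a small arc in the uncovered part of the patch
  has room for any finite matching.\<close>

section \<open>Drawings of graphs\<close>

text \<open>Two obstacles shape the proof. The arcs of an embedding are merely continuous and may be
  wild, even of positive area, so free room on the surface cannot come from measure or tameness. It
  comes from topology: an arc is a copy of an interval, and no open piece of the plane injects
  continuously into the line. The group is given by a presentation, so even the distinctness of its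
  elements needs proof. Rewriting to the words \<open>r ^ i * s ^ e\<close> bounds the order by
  \<open>4 * m\<close>; an affine action on the integers modulo \<open>2 * m\<close>, possible
  because \<open>m - 1\<close> squares to 1 there, tells these words apart. Commutation then amounts
  to divisibility of multiples of \<open>m - 2\<close> by \<open>2 * m\<close>. Since
  \<open>4 dvd m\<close>, the number \<open>m / 2 - 1\<close> is odd, hence coprime to
  \<open>m\<close>, and divisibility by \<open>m\<close> of the other factor remains. This is the
  source of the modulus \<open>m\<close> for reflections and of the bound
  \<open>n \<ge> 4\<close>.\<close>

definition drawing ::
    "('a \<Rightarrow> 'c::topological_space) \<Rightarrow> ('a set \<Rightarrow> real \<Rightarrow> 'c) \<Rightarrow> 'a set \<Rightarrow> 'a set set \<Rightarrow> 'c set \<Rightarrow> bool" where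
  "drawing p \<gamma> V E S \<longleftrightarrow>
     inj_on p V \<and> p ` V \<subseteq> S \<and>
     (\<forall>e\<in>E. arc (\<gamma> e) \<and> path_image (\<gamma> e) \<subseteq> S \<and>
        {pathstart (\<gamma> e), pathfinish (\<gamma> e)} = p ` e \<and>
        path_image (\<gamma> e) \<inter> p ` V = p ` e) \<and>
     (\<forall>e\<in>E. \<forall>f\<in>E. e \<noteq> f \<longrightarrow>
        path_image (\<gamma> e) \<inter> path_image (\<gamma> f) = p ` (e \<inter> f))"

text \<open>With vertex and edge sets as explicit parameters, subgraphs, unions and relabellings can
  be handled without building digraphs.\<close>

lemma embeddable_in_iff_drawing:
  "embeddable_in \<Gamma> S \<longleftrightarrow> (\<exists>p \<gamma>. drawing p \<gamma> (verts \<Gamma>) (edges \<Gamma>) S)"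
  unfolding embeddable_in_def drawing_def by simp

text \<open>Serves two purposes: relabelling along a bijection, and restriction to a subgraph with
  \<open>f = id\<close>. Injectivity of \<open>f\<close> lets images commute with intersections of
  edges.\<close>

lemma drawing_pullback:
  assumes d: "drawing p \<gamma> V E S" and inj: "inj_on f V'" and "f ` V' \<subseteq> V"
    and E': "\<And>e. e \<in> E' \<Longrightarrow> e \<subseteq> V' \<and> f ` e \<in> E"
  shows "drawing (p \<circ> f) (\<lambda>e. \<gamma> (f ` e)) V' E' S"
proof -
  have dV: "inj_on p V" "p ` V \<subseteq> S"
    and dE: "\<And>e. e \<in> E \<Longrightarrow> arc (\<gamma> e) \<and> path_image (\<gamma> e) \<subseteq> S \<and>
        {pathstart (\<gamma> e), pathfinish (\<gamma> e)} = p ` e \<and> path_image (\<gamma> e) \<inter> p ` V = p ` e"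
    and dEE: "\<And>e e'. e \<in> E \<Longrightarrow> e' \<in> E \<Longrightarrow> e \<noteq> e' \<Longrightarrow>
        path_image (\<gamma> e) \<inter> path_image (\<gamma> e') = p ` (e \<inter> e')"
    using d unfolding drawing_def by auto
  have inj': "inj_on (p \<circ> f) V'"
    using inj dV(1) assms(3) by (meson comp_inj_on inj_on_subset)
  show ?thesis
    unfolding drawing_def
  proof (intro conjI ballI impI)
    show "inj_on (p \<circ> f) V'" by (fact inj')
    show "(p \<circ> f) ` V' \<subseteq> S" using dV(2) assms(3) by auto
  next
    fix e assume e: "e \<in> E'"
    note fe = dE[OF conjunct2[OF E'[OF e]]]
    show "arc (\<gamma> (f ` e))" "path_image (\<gamma> (f ` e)) \<subseteq> S"
      "{pathstart (\<gamma> (f ` e)), pathfinish (\<gamma> (f ` e))} = (p \<circ> f) ` e"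
      using fe by (auto simp: image_comp)
    have "(p \<circ> f) ` V' \<subseteq> p ` V" using assms(3) by auto
    moreover have "(p \<circ> f) ` e \<subseteq> (p \<circ> f) ` V'" using E'[OF e] by auto
    moreover have "path_image (\<gamma> (f ` e)) \<inter> p ` V = (p \<circ> f) ` e"
      using fe by (simp add: image_comp)
    ultimately show "path_image (\<gamma> (f ` e)) \<inter> (p \<circ> f) ` V' = (p \<circ> f) ` e"
      unfolding set_eq_iff subset_iff Int_iff by meson
  next
    fix e e' assume e: "e \<in> E'" and e': "e' \<in> E'" and ne: "e \<noteq> e'"
    have "f ` e \<noteq> f ` e'"
      using inj_on_image_eq_iff[OF inj] E'[OF e] E'[OF e'] ne by blast
    then have "path_image (\<gamma> (f ` e)) \<inter> path_image (\<gamma> (f ` e')) = p ` (f ` e \<inter> f ` e')"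
      using dEE E'[OF e] E'[OF e'] by blast
    also have "f ` e \<inter> f ` e' = f ` (e \<inter> e')"
      using inj_on_image_Int[OF inj] E'[OF e] E'[OF e'] by blast
    finally show "path_image (\<gamma> (f ` e)) \<inter> path_image (\<gamma> (f ` e')) = (p \<circ> f) ` (e \<inter> e')"
      by (simp add: image_comp)
  qed
qed

lemma embeddable_in_iff_drawing_iso:
  assumes bij: "bij_betw f V (verts \<Gamma>)" and edges: "edges \<Gamma> = (`) f ` E" and E: "E \<subseteq> Pow V"
  shows "embeddable_in \<Gamma> S \<longleftrightarrow> (\<exists>p \<gamma>. drawing p \<gamma> V E S)"
proof
  assume "embeddable_in \<Gamma> S"
  then obtain p \<gamma> where "drawing p \<gamma> (verts \<Gamma>) (edges \<Gamma>) S"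
    by (auto simp: embeddable_in_iff_drawing)
  then have "drawing (p \<circ> f) (\<lambda>e. \<gamma> (f ` e)) V E S"
    by (rule drawing_pullback) (use bij edges E in \<open>auto simp: bij_betw_def\<close>)
  then show "\<exists>p \<gamma>. drawing p \<gamma> V E S" by blast
next
  let ?g = "inv_into V f"
  have g: "bij_betw ?g (verts \<Gamma>) V" using bij by (rule bij_betw_inv_into)
  assume "\<exists>p \<gamma>. drawing p \<gamma> V E S"
  then obtain p \<gamma> where "drawing p \<gamma> V E S" by blast
  then have "drawing (p \<circ> ?g) (\<lambda>e. \<gamma> (?g ` e)) (verts \<Gamma>) (edges \<Gamma>) S"
  proof (rule drawing_pullback)
    show "inj_on ?g (verts \<Gamma>)" "?g ` verts \<Gamma> \<subseteq> V" using g by (auto simp: bij_betw_def)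
  next
    fix e assume "e \<in> edges \<Gamma>"
    then obtain e0 where e0: "e0 \<in> E" "e = f ` e0" "e0 \<subseteq> V" using edges E by auto
    then have "?g ` e = e0" using bij by (simp add: bij_betw_def inv_into_image_cancel)
    then show "e \<subseteq> verts \<Gamma> \<and> ?g ` e \<in> E" using e0 bij by (auto simp: bij_betw_def)
  qed
  then show "embeddable_in \<Gamma> S" by (auto simp: embeddable_in_iff_drawing)
qed

lemma edges_eq_image:
  assumes "arcs_ends \<Gamma> = {(f x, f y) | x y. P x y}"
  shows "edges \<Gamma> = (`) f ` {{x, y} | x y. P x y}"
proof (intro equalityI subsetI)
  fix e assume "e \<in> edges \<Gamma>"
  then obtain x y where "e = {f x, f y}" "P x y" unfolding edges_def assms by blast
  then have "e = f ` {x, y}" "{x, y} \<in> {{x, y} | x y. P x y}" by auto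
  then show "e \<in> (`) f ` {{x, y} | x y. P x y}" by (rule image_eqI)
next
  fix e assume "e \<in> (`) f ` {{x, y} | x y. P x y}"
  then obtain x y where "e = {f x, f y}" "P x y" by auto
  then show "e \<in> edges \<Gamma>" unfolding edges_def assms by blast
qed

text \<open>The second drawing lives in a region \<open>S'\<close> that the first one avoids, so no
  mixed intersections arise. Excluding the empty edge makes \<open>E\<close> and \<open>E'\<close>
  disjoint, so that the test \<open>e \<in> E\<close> always selects the right curve.\<close>

lemma drawing_disjoint_union:
  assumes d: "drawing p \<gamma> V E S" and d': "drawing p' \<gamma>' V' E' S'"
    and "S' \<subseteq> S" and sep: "p ` V \<inter> S' = {}" "\<And>e. e \<in> E \<Longrightarrow> path_image (\<gamma> e) \<inter> S' = {}"
    and VV': "V \<inter> V' = {}" and E: "E \<subseteq> Pow V - {{}}" and E': "E' \<subseteq> Pow V' - {{}}"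
  shows "drawing (\<lambda>v. if v \<in> V then p v else p' v) (\<lambda>e. if e \<in> E then \<gamma> e else \<gamma>' e)
    (V \<union> V') (E \<union> E') S"
proof -
  let ?p = "\<lambda>v. if v \<in> V then p v else p' v" and ?g = "\<lambda>e. if e \<in> E then \<gamma> e else \<gamma>' e"
  have dV: "inj_on p V" "p ` V \<subseteq> S"
    and dE: "\<And>e. e \<in> E \<Longrightarrow> arc (\<gamma> e) \<and> path_image (\<gamma> e) \<subseteq> S \<and>
        {pathstart (\<gamma> e), pathfinish (\<gamma> e)} = p ` e \<and> path_image (\<gamma> e) \<inter> p ` V = p ` e"
    and dEE: "\<And>e e'. e \<in> E \<Longrightarrow> e' \<in> E \<Longrightarrow> e \<noteq> e' \<Longrightarrow>
        path_image (\<gamma> e) \<inter> path_image (\<gamma> e') = p ` (e \<inter> e')"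
    using d unfolding drawing_def by auto
  have dV': "inj_on p' V'" "p' ` V' \<subseteq> S'"
    and dE': "\<And>e. e \<in> E' \<Longrightarrow> arc (\<gamma>' e) \<and> path_image (\<gamma>' e) \<subseteq> S' \<and>
        {pathstart (\<gamma>' e), pathfinish (\<gamma>' e)} = p' ` e \<and> path_image (\<gamma>' e) \<inter> p' ` V' = p' ` e"
    and dEE': "\<And>e e'. e \<in> E' \<Longrightarrow> e' \<in> E' \<Longrightarrow> e \<noteq> e' \<Longrightarrow>
        path_image (\<gamma>' e) \<inter> path_image (\<gamma>' e') = p' ` (e \<inter> e')"
    using d' unfolding drawing_def by auto
  have notE: "e \<notin> E" if "e \<in> E'" for e using that E E' VV' by blast
  have pe: "?p ` e = p ` e" if "e \<subseteq> V" for e using that by (intro image_cong) auto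
  have pe': "?p ` e = p' ` e" if "e \<subseteq> V'" for e using that VV' by (intro image_cong) auto
  have pVV': "?p ` (V \<union> V') = p ` V \<union> p' ` V'" by (simp only: image_Un pe[OF subset_refl] pe'[OF subset_refl])
  show ?thesis
    unfolding drawing_def
  proof (intro conjI ballI impI)
    have "inj_on ?p V" using dV(1) by (simp add: inj_on_def)
    moreover have "inj_on ?p V'" using dV'(1) VV' by (auto simp: inj_on_def)
    moreover have "?p ` (V - V') \<inter> ?p ` (V' - V) = {}"
    proof -
      have "?p ` (V - V') \<subseteq> p ` V" "?p ` (V' - V) \<subseteq> S'" using dV'(2) by auto
      then show ?thesis using sep(1) by blast
    qed
    ultimately show "inj_on ?p (V \<union> V')" unfolding inj_on_Un by blast
    show "?p ` (V \<union> V') \<subseteq> S" using pVV' dV(2) dV'(2) assms(3) by auto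
  next
    fix e assume "e \<in> E \<union> E'"
    then consider "e \<in> E" "e \<subseteq> V" | "e \<in> E'" "e \<notin> E" "e \<subseteq> V'" using E E' notE by blast
    note cases = this
    show "arc (?g e)" by (cases rule: cases) (use dE dE' in auto)
    show "path_image (?g e) \<subseteq> S" 
    proof (cases rule: cases)
      case 1
      then show ?thesis using dE by simp
    next
      case 2
      then show ?thesis using dE'[OF 2(1)] assms(3) by auto
    qed
    show "{pathstart (?g e), pathfinish (?g e)} = ?p ` e"
      by (cases rule: cases) (use dE dE' pe pe' in \<open>simp_all\<close>)
    show "path_image (?g e) \<inter> ?p ` (V \<union> V') = ?p ` e"
    proof (cases rule: cases)
      case 1
      have "path_image (\<gamma> e) \<inter> p' ` V' = {}" using sep(2)[OF 1(1)] dV'(2) by blast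
      then show ?thesis unfolding pVV' pe[OF 1(2)] using 1 dE[OF 1(1)] by (simp add: Int_Un_distrib)
    next
      case 2
      have "path_image (\<gamma>' e) \<inter> p ` V = {}" using sep(1) dE'[OF 2(1)] by blast
      then show ?thesis unfolding pVV' pe'[OF 2(3)] using 2 dE'[OF 2(1)] by (simp add: Int_Un_distrib)
    qed
  next
    fix e e' assume e: "e \<in> E \<union> E'" and e': "e' \<in> E \<union> E'" and ne: "e \<noteq> e'"
    have mixed: "path_image (\<gamma> a) \<inter> path_image (\<gamma>' b) = {}" "a \<inter> b = {}"
      if "a \<in> E" "b \<in> E'" for a b
      using sep(2)[OF that(1)] dE'[OF that(2)] that E E' VV' by blast+
    from e e' consider "e \<in> E" "e' \<in> E" | "e \<in> E" "e' \<in> E'" | "e \<in> E'" "e' \<in> E" | "e \<in> E'" "e' \<in> E'"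
      by blast
    then show "path_image (?g e) \<inter> path_image (?g e') = ?p ` (e \<inter> e')"
    proof cases
      case 1
      have "e \<inter> e' \<subseteq> V" using 1 E by blast
      then show ?thesis using 1 dEE[OF 1 ne] pe by simp
    next
      case 2
      then show ?thesis using mixed[OF 2] notE by simp
    next
      case 3
      then show ?thesis using mixed[OF 3(2,1)] notE by (simp add: Int_commute)
    next
      case 4
      have "e \<inter> e' \<subseteq> V'" using 4 E' by blast
      then show ?thesis using 4 dEE'[OF 4 ne] pe' notE by simp
    qed
  qed
qed

text \<open>The numbering \<open>h\<close> encodes a matching: partners receive consecutive numbers
  \<open>2 * i\<close> and \<open>2 * i + 1\<close>. Placing the vertices along
  \<open>\<sigma>\<close> in this order makes the edges pairwise disjoint subarcs.\<close>

lemma drawing_matching_in_arc: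
  fixes \<sigma> :: "real \<Rightarrow> 'c::real_normed_vector" and h :: "'a \<Rightarrow> nat"
  assumes "arc \<sigma>" "finite V" and inj: "inj_on h V"
    and E: "\<And>e. e \<in> E \<Longrightarrow> e \<subseteq> V \<and> (\<exists>i. h ` e = {2 * i, 2 * i + 1})"
  shows "\<exists>p \<gamma>. drawing p \<gamma> V E (path_image \<sigma>)"
proof -
  obtain M where M: "\<And>v. v \<in> V \<Longrightarrow> h v < M" and M0: "M > 0"
  proof
    show "h v < Suc (Max (h ` V))" if "v \<in> V" for v using that assms(2) by (simp add: le_imp_less_Suc)
  qed simp
  have sinj: "inj_on \<sigma> {0..1}" using assms(1) by (simp add: arc_def)
  \<comment> \<open>\<open>M\<close> strictly bounds all numbers in use, so every vertex gets a
    parameter in the unit interval.\<close>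
  define \<tau> where "\<tau> k = real k / real M" for k
  have tau_le: "\<tau> a \<le> \<tau> b \<longleftrightarrow> a \<le> b" for a b using M0 by (simp add: \<tau>_def divide_le_cancel)
  have tau_eq: "\<tau> a = \<tau> b \<longleftrightarrow> a = b" for a b using M0 by (simp add: \<tau>_def)
  have tau01: "\<tau> (h v) \<in> {0..1}" if "v \<in> V" for v using M[OF that] by (simp add: \<tau>_def)
  define p where "p v = \<sigma> (\<tau> (h v))" for v
  \<comment> \<open>An edge is an unordered set; \<open>Min\<close> and \<open>Max\<close> recover
    \<open>2 * i\<close> and \<open>2 * i + 1\<close> and so fix a direction.\<close>
  define \<gamma> where "\<gamma> e = subpath (\<tau> (Min (h ` e))) (\<tau> (Max (h ` e))) \<sigma>" for e
  have edge: "\<exists>u v i. u \<in> V \<and> v \<in> V \<and> e = {u, v} \<and> h u = 2 * i \<and> h v = 2 * i + 1 \<and>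
      \<gamma> e = subpath (\<tau> (2 * i)) (\<tau> (2 * i + 1)) \<sigma>" if e: "e \<in> E" for e
  proof -
    obtain i where i: "h ` e = {2 * i, 2 * i + 1}" and eV: "e \<subseteq> V" using E[OF e] by blast
    obtain u where u: "u \<in> e" "h u = 2 * i" using i by (metis imageE insertI1)
    obtain v where v: "v \<in> e" "h v = 2 * i + 1" using i by (metis imageE insertI1 insertI2)
    have "e = {u, v}"
    proof -
      have "h ` e = h ` {u, v}" using i u v by simp
      then show ?thesis using inj_on_image_eq_iff[OF inj eV, of "{u, v}"] u v eV by auto
    qed
    then show ?thesis using i u v eV by (intro exI[of _ u] exI[of _ v] exI[of _ i]) (auto simp: \<gamma>_def)
  qed
  have image: "path_image (\<gamma> e) = \<sigma> ` {\<tau> (2 * i)..\<tau> (2 * i + 1)}"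
    if "\<gamma> e = subpath (\<tau> (2 * i)) (\<tau> (2 * i + 1)) \<sigma>" for e i
    using that by (simp add: path_image_subpath tau_le)
  show ?thesis
  proof (intro exI)
    show "drawing p \<gamma> V E (path_image \<sigma>)"
      unfolding drawing_def
    proof (intro conjI ballI impI)
      show "inj_on p V"
        using inj inj_onD[OF sinj _ tau01 tau01] by (auto simp: inj_on_def p_def tau_eq)
      show "p ` V \<subseteq> path_image \<sigma>" using tau01 by (auto simp: p_def path_image_def)
    next
      fix e assume "e \<in> E"
      then obtain u v i where e: "u \<in> V" "v \<in> V" "e = {u, v}" "h u = 2 * i" "h v = 2 * i + 1"
        "\<gamma> e = subpath (\<tau> (2 * i)) (\<tau> (2 * i + 1)) \<sigma>" using edge by blast
      have ends: "\<tau> (2 * i) \<in> {0..1}" "\<tau> (2 * i + 1) \<in> {0..1}" using tau01 e by metis+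
      show "arc (\<gamma> e)" unfolding e(6)
        by (rule arc_subpath_arc) (use assms(1) ends in \<open>simp_all add: tau_eq\<close>)
      show "path_image (\<gamma> e) \<subseteq> path_image \<sigma>" unfolding e(6)
        using path_image_subpath_subset ends by metis
      show "{pathstart (\<gamma> e), pathfinish (\<gamma> e)} = p ` e"
        unfolding e(6) unfolding e(3) by (simp add: p_def e(4,5))
      have "w \<in> e" if w: "w \<in> V" and on: "p w \<in> path_image (\<gamma> e)" for w
      proof -
        obtain t where t: "\<tau> (2 * i) \<le> t" "t \<le> \<tau> (2 * i + 1)" "\<sigma> (\<tau> (h w)) = \<sigma> t"
          using on unfolding image[OF e(6)] p_def by auto
        have "\<tau> (h w) = t" using inj_onD[OF sinj t(3) tau01[OF w]] t ends by auto
        then have "2 * i \<le> h w" "h w \<le> 2 * i + 1" using t tau_le by metis+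
        then have "h w = h u \<or> h w = h v" using e by linarith
        then show ?thesis using inj_onD[OF inj _ w] e by auto
      qed
      moreover have "p ` e \<subseteq> path_image (\<gamma> e)"
        using e tau_le unfolding image[OF e(6)] p_def by auto
      ultimately show "path_image (\<gamma> e) \<inter> p ` V = p ` e" using e by auto
    next
      fix e e' assume ee: "e \<in> E" "e' \<in> E" "e \<noteq> e'"
      then obtain u v i where e: "u \<in> V" "v \<in> V" "e = {u, v}" "h u = 2 * i" "h v = 2 * i + 1"
        "\<gamma> e = subpath (\<tau> (2 * i)) (\<tau> (2 * i + 1)) \<sigma>" using edge by blast
      from ee obtain u' v' i' where e': "u' \<in> V" "v' \<in> V" "e' = {u', v'}" "h u' = 2 * i'"
        "h v' = 2 * i' + 1" "\<gamma> e' = subpath (\<tau> (2 * i')) (\<tau> (2 * i' + 1)) \<sigma>" using edge by blast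
      have "i \<noteq> i'" using ee(3) e e' inj_onD[OF inj, of u u'] inj_onD[OF inj, of v v'] by auto
      then have "\<not> \<tau> (2 * i) \<le> \<tau> (2 * i' + 1) \<or> \<not> \<tau> (2 * i') \<le> \<tau> (2 * i + 1)"
        unfolding tau_le by linarith
      then have disj: "{\<tau> (2 * i)..\<tau> (2 * i + 1)} \<inter> {\<tau> (2 * i')..\<tau> (2 * i' + 1)} = {}"
        by auto
      have sub: "{\<tau> (2 * i)..\<tau> (2 * i + 1)} \<subseteq> {0..1}" "{\<tau> (2 * i')..\<tau> (2 * i' + 1)} \<subseteq> {0..1}"
        using tau01[OF e(1)] tau01[OF e(2)] tau01[OF e'(1)] tau01[OF e'(2)] e e' by auto
      have "path_image (\<gamma> e) \<inter> path_image (\<gamma> e') = {}"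
        unfolding image[OF e(6)] image[OF e'(6)] inj_on_image_Int[OF sinj sub, symmetric] disj by simp
      moreover have "e \<inter> e' = {}" using e e' \<open>i \<noteq> i'\<close> by auto
      ultimately show "path_image (\<gamma> e) \<inter> path_image (\<gamma> e') = p ` (e \<inter> e')" by simp
    qed
  qed
qed

section \<open>Free room on the surface\<close>

text \<open>The arcs are removed one at a time. Each is compact, so the part of the patch mapped off
  it is again open; that it is nonempty is the point where the dimension enters.\<close>

lemma open_patch_avoiding_arcs:
  fixes \<phi> :: "'a::euclidean_space \<Rightarrow> 'b::real_normed_vector"
  assumes "finite A" "\<And>\<gamma>. \<gamma> \<in> A \<Longrightarrow> arc \<gamma>" and "DIM('a) \<ge> 2"
    and "open U" "U \<noteq> {}" "continuous_on U \<phi>" "inj_on \<phi> U"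
  shows "\<exists>W\<subseteq>U. open W \<and> W \<noteq> {} \<and> \<phi> ` W \<inter> (\<Union>\<gamma>\<in>A. path_image \<gamma>) = {}"
  using assms(1,2)
proof (induction A)
  case empty
  then show ?case using assms by auto
next
  case (insert \<gamma> A)
  then obtain W where W: "W \<subseteq> U" "open W" "W \<noteq> {}" "\<phi> ` W \<inter> (\<Union>\<gamma>\<in>A. path_image \<gamma>) = {}"
    by (metis insertCI)
  have arc: "arc \<gamma>" using insert.prems by simp
  have cont: "continuous_on W \<phi>" and inj: "inj_on \<phi> W"
    using assms W(1) continuous_on_subset inj_on_subset by blast+
  let ?W' = "W \<inter> \<phi> -` (- path_image \<gamma>)"
  have "open ?W'"
    using continuous_open_preimage[OF cont W(2)] arc by (simp add: closed_arc_image open_Compl)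
  moreover have "?W' \<noteq> {}" \<comment> \<open>otherwise \<open>W\<close> would embed in the real line\<close>
  proof
    assume "?W' = {}"
    then have sub: "\<phi> ` W \<subseteq> path_image \<gamma>" by auto
    obtain \<psi> where \<psi>: "homeomorphism {0..1} (path_image \<gamma>) \<gamma> \<psi>"
      using homeomorphism_arc[OF arc] by blast
    have "continuous_on W (\<psi> \<circ> \<phi>)"
      using cont sub \<psi> by (meson continuous_on_compose continuous_on_subset homeomorphism_cont2)
    moreover have "inj_on (\<psi> \<circ> \<phi>) W"
    proof (rule comp_inj_on[OF inj])
      have "inj_on \<psi> (path_image \<gamma>)"
        using \<psi> by (metis homeomorphism_apply2 inj_on_inverseI)
      then show "inj_on \<psi> (\<phi> ` W)" using sub by (rule inj_on_subset)
    qed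
    ultimately have "DIM('a) \<le> DIM(real)"
      using W(2,3) by (intro invariance_of_dimension)
    with assms(3) show False by simp
  qed
  moreover have "\<phi> ` ?W' \<inter> (\<Union>\<gamma>\<in>insert \<gamma> A. path_image \<gamma>) = {}" using W(4) by auto
  ultimately show ?case using W(1) by (intro exI[of _ ?W']) auto
qed

text \<open>The patch lies over the points of the disc of radius \<open>3 * g + 1\<close> with real part less than
  \<open>- (3 * g + 1) / 2\<close>, out of reach of all handles.\<close>

lemma sphere_with_handles_patch:
  obtains U and \<phi> :: "complex \<Rightarrow> complex \<times> real"
  where "open U" "U \<noteq> {}" "continuous_on U \<phi>" "inj_on \<phi> U" "\<phi> ` U \<subseteq> sphere_with_handles g"
proof
  define R where "R = 3 * real g + 1"
  have R: "R \<ge> 1" by (simp add: R_def)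
  let ?U = "ball 0 R \<inter> {w. Re w < - R / 2}"
  \<comment> \<open>The upper hemisphere as a graph over the disc; the first component makes
    injectivity immediate.\<close>
  let ?\<phi> = "\<lambda>w::complex. (w, sqrt (R\<^sup>2 - (cmod w)\<^sup>2))"
  show "open ?U" by (intro open_Int open_ball open_halfspace_Re_lt)
  \<comment> \<open>The midpoint between \<open>- R\<close> and \<open>- R / 2\<close>.\<close>
  have "complex_of_real (- 3 * R / 4) \<in> ?U" using R by (simp del: of_real_mult of_real_divide of_real_minus)
  then show "?U \<noteq> {}" by blast
  show "continuous_on ?U ?\<phi>" by (intro continuous_intros)
  show "inj_on ?\<phi> ?U" by (auto simp: inj_on_def)
  show "?\<phi> ` ?U \<subseteq> sphere_with_handles g"
  proof (rule image_subsetI)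
    fix w assume "w \<in> ?U"
    then have w: "cmod w < R" "Re w < - R / 2" by auto
    have "(cmod w)\<^sup>2 \<le> R\<^sup>2" using w(1) by (intro power_mono) auto
    then have "norm (?\<phi> w) = R" using R by (simp add: norm_Pair)
    moreover have "?\<phi> w \<notin> handle_disc i" if "i < g" for i
    proof -
      \<comment> \<open>A handle exists only if \<open>g \<ge> 1\<close>, which makes
        \<open>Re w < - 2\<close>, whereas the cylinders have radius 1 about axes with nonnegative
        real part.\<close>
      have "1 \<le> g" using that by simp
      then have "R \<ge> 4" by (simp add: R_def)
      have "cmod (w - of_nat (3 * i)) \<ge> \<bar>Re (w - of_nat (3 * i))\<bar>" by (rule abs_Re_le_cmod)
      moreover have "Re (w - of_nat (3 * i)) < - 1" using w(2) \<open>R \<ge> 4\<close> by simp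
      ultimately show ?thesis by (simp add: handle_disc_def)
    qed
    ultimately show "?\<phi> w \<in> sphere_with_handles g"
      by (auto simp: sphere_with_handles_def R_def)
  qed
qed

lemma drawing_add_matching:
  fixes h :: "'a \<Rightarrow> nat"
  assumes d: "drawing p \<gamma> V E (sphere_with_handles g)"
    and fin: "finite V" "finite E" "finite V'"
    and VV': "V \<inter> V' = {}" and E: "E \<subseteq> Pow V - {{}}"
    and h: "inj_on h V'" "\<And>e. e \<in> E' \<Longrightarrow> e \<subseteq> V' \<and> (\<exists>i. h ` e = {2 * i, 2 * i + 1})"
  shows "\<exists>p \<gamma>. drawing p \<gamma> (V \<union> V') (E \<union> E') (sphere_with_handles g)"
proof -
  obtain U and \<phi> :: "complex \<Rightarrow> complex \<times> real"
    where U: "open U" "U \<noteq> {}" "continuous_on U \<phi>" "inj_on \<phi> U" "\<phi> ` U \<subseteq> sphere_with_handles g"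
    using sphere_with_handles_patch by blast
  have arcs: "\<And>e. e \<in> E \<Longrightarrow> arc (\<gamma> e)" using d by (auto simp: drawing_def)
  obtain W0 where W0: "W0 \<subseteq> U" "open W0" "W0 \<noteq> {}" "\<phi> ` W0 \<inter> (\<Union>\<gamma>\<in>\<gamma> ` E. path_image \<gamma>) = {}"
    using open_patch_avoiding_arcs[of "\<gamma> ` E" U \<phi>] fin(2) arcs U by (metis DIM_complex finite_imageI imageE order_refl)
  \<comment> \<open>A vertex without edges lies on no arc, so the vertex images must be removed
    separately; by injectivity of \<open>\<phi>\<close> this deletes only finitely many
    points.\<close>
  define W where "W = W0 - \<phi> -` (p ` V) \<inter> W0"
  have finW: "finite (\<phi> -` (p ` V) \<inter> W0)"
    using fin(1) U(4) W0(1) by (intro finite_vimage_IntI) (auto intro: inj_on_subset)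
  then have "open W" using W0(2) by (simp add: W_def open_Diff finite_imp_closed)
  moreover have "W \<noteq> {}"
  proof -
    have "infinite W0" using W0(2,3) by (metis finite_imp_not_open)
    then show ?thesis using finW by (metis W_def finite.emptyI finite_Diff2)
  qed
  ultimately obtain a \<epsilon> where \<epsilon>: "\<epsilon> > 0" "cball a \<epsilon> \<subseteq> W"
    by (metis all_not_in_conv open_contains_cball)
  \<comment> \<open>A radius of a closed ball inside \<open>W\<close>, carried to the surface, is
    the arc that will hold the whole matching.\<close>
  define \<sigma> where "\<sigma> = \<phi> \<circ> linepath a (a + of_real \<epsilon>)"
  have seg: "path_image (linepath a (a + of_real \<epsilon>)) \<subseteq> W"
    unfolding path_image_linepath using \<epsilon>
    by (intro order.trans[OF closed_segment_subset \<epsilon>(2)]) (auto simp: dist_norm)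
  have WU: "W \<subseteq> U" using W0(1) by (auto simp: W_def)
  have "arc \<sigma>"
    unfolding \<sigma>_def arc_def
  proof
    have "arc (linepath a (a + of_real \<epsilon>))" using \<epsilon>(1) by (intro arc_linepath) simp
    moreover have cont: "continuous_on (path_image (linepath a (a + of_real \<epsilon>))) \<phi>"
      and inj: "inj_on \<phi> (path_image (linepath a (a + of_real \<epsilon>)))"
      using U seg WU by (meson continuous_on_subset inj_on_subset order.trans)+
    ultimately show "path (\<phi> \<circ> linepath a (a + of_real \<epsilon>))"
      "inj_on (\<phi> \<circ> linepath a (a + of_real \<epsilon>)) {0..1}"
      by (auto simp: arc_def path_image_def intro: path_continuous_image comp_inj_on)
  qed
  then obtain p' \<gamma>' where d': "drawing p' \<gamma>' V' E' (path_image \<sigma>)"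
    using drawing_matching_in_arc[OF _ fin(3) h] by blast
  have im: "path_image \<sigma> \<subseteq> \<phi> ` W" using seg by (auto simp: \<sigma>_def path_image_compose)
  have "drawing (\<lambda>v. if v \<in> V then p v else p' v) (\<lambda>e. if e \<in> E then \<gamma> e else \<gamma>' e)
    (V \<union> V') (E \<union> E') (sphere_with_handles g)"
  proof (rule drawing_disjoint_union[OF d d' _ _ _ VV' E])
    show "path_image \<sigma> \<subseteq> sphere_with_handles g" using im WU U(5) by blast
    show "p ` V \<inter> path_image \<sigma> = {}" using im by (auto simp: W_def)
    show "path_image (\<gamma> e) \<inter> path_image \<sigma> = {}" if "e \<in> E" for e
    proof -
      have "path_image \<sigma> \<subseteq> \<phi> ` W0" using im by (auto simp: W_def)
      moreover have "\<phi> ` W0 \<inter> path_image (\<gamma> e) = {}" using W0(4) that by auto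
      ultimately show ?thesis by blast
    qed
    show "E' \<subseteq> Pow V' - {{}}"
    proof
      fix e assume "e \<in> E'"
      from h(2)[OF this] have "e \<subseteq> V'" "h ` e \<noteq> {}" by auto
      then show "e \<in> Pow V' - {{}}" by simp
    qed
  qed
  then show ?thesis by blast
qed

section \<open>Words in the semidihedral group\<close>

text \<open>The normal form \<open>r ^ i * s ^ e\<close>; group elements correspond to
  \<open>i < 2 * m\<close> and \<open>e < 2\<close>.\<close>

abbreviation sd_word :: "nat \<Rightarrow> nat \<Rightarrow> sd_gen word" where
  "sd_word i e \<equiv> replicate i (Gen_r, True) @ replicate e (Gen_s, True)"

definition sd_rels :: "nat \<Rightarrow> (sd_gen word \<times> sd_gen word) set" where
  "sd_rels m = {(sd_word (2 * m) 0, []), (sd_word 0 2, []),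
     ([(Gen_s, True), (Gen_r, True), (Gen_s, True)], sd_word (m - 1) 0)}"

lemma semidihedral_eq_presented_group:
  assumes "n \<ge> 2"
  shows "semidihedral n = presented_group (sd_rels (2 ^ (n - 2)))"
proof -
  have "n - 1 = Suc (n - 2)" using assms by simp
  then have "(2::nat) ^ (n - 1) = 2 * 2 ^ (n - 2)" by (simp only: power_Suc)
  then show ?thesis by (simp add: semidihedral_def sd_rels_def Let_def numeral_2_eq_2)
qed

lemma word_eq_replicate_mod:
  assumes "word_eq R (replicate k a) []"
  shows "word_eq R (replicate i a) (replicate (i mod k) a)"
proof (induction i rule: less_induct)
  case (less i)
  show ?case
  \<comment> \<open>For \<open>k = 0\<close> both words coincide, since
    \<open>i mod 0 = i\<close>.\<close>
  proof (cases "k = 0 \<or> i < k")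
    case True
    then show ?thesis by (auto simp: word_eq.refl)
  next
    case False
    then have "word_eq R (replicate (i - k) a) (replicate (i mod k) a)"
      using less by (simp add: le_mod_geq)
    with assms have "word_eq R (replicate k a @ replicate (i - k) a) ([] @ replicate (i mod k) a)"
      by (rule word_eq_append)
    then show ?thesis using False by (simp flip: replicate_add)
  qed
qed

lemma sd_rels_word_eq:
  "word_eq (sd_rels m) (sd_word (2 * m) 0) []"
  "word_eq (sd_rels m) (sd_word 0 2) []"
  "word_eq (sd_rels m) [(Gen_s, True), (Gen_r, True), (Gen_s, True)] (sd_word (m - 1) 0)"
  using word_eq.relation[where rels = "sd_rels m" and p = "[]" and q = "[]"]
  by (auto simp: sd_rels_def)

text \<open>Multiplying the relation for \<open>s r s\<close> by \<open>s\<close> on the right gives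
  \<open>s r = r ^ (m - 1) s\<close>; iterating moves \<open>s\<close> past a power of
  \<open>r\<close>.\<close>

lemma word_eq_swap_generators:
  "word_eq (sd_rels m) ((Gen_s, True) # sd_word i 0) (sd_word ((m - 1) * i) 1)"
proof (induction i)
  case 0
  show ?case by (simp add: word_eq.refl)
next
  case (Suc i)
  let ?s = "(Gen_s, True)" and ?r = "(Gen_r, True)"
  have "word_eq (sd_rels m) ([?s, ?r] @ sd_word 0 2) ([?s, ?r] @ [])"
    by (intro word_eq_append word_eq.refl sd_rels_word_eq)
  moreover have "word_eq (sd_rels m) ([?s, ?r, ?s] @ [?s]) (sd_word (m - 1) 0 @ [?s])"
    by (intro word_eq_append word_eq.refl sd_rels_word_eq)
  ultimately have "word_eq (sd_rels m) [?s, ?r] (sd_word (m - 1) 1)"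
    by (simp add: numeral_2_eq_2) (metis word_eq.trans word_eq.sym)
  then have "word_eq (sd_rels m) ([?s, ?r] @ sd_word i 0) (sd_word (m - 1) 1 @ sd_word i 0)"
    by (intro word_eq_append word_eq.refl)
  moreover have "word_eq (sd_rels m) (sd_word (m - 1) 0 @ (?s # sd_word i 0))
      (sd_word (m - 1) 0 @ sd_word ((m - 1) * i) 1)"
    by (intro word_eq_append word_eq.refl Suc.IH)
  ultimately have "word_eq (sd_rels m) ([?s, ?r] @ sd_word i 0)
      (sd_word (m - 1) 0 @ sd_word ((m - 1) * i) 1)"
    by (simp add: word_eq.trans)
  then show ?case by (simp add: replicate_add)
qed

text \<open>Letters are absorbed from the right end of the word: \<open>r\<close> raises the
  exponent, \<open>s\<close> is swapped past the rotation, and the formal inverses equal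
  \<open>r ^ (2 * m - 1)\<close> and \<open>s\<close>. The exponents are reduced only at the
  end.\<close>

lemma word_eq_sd_word:
  assumes "m > 0"
  shows "\<exists>i<2 * m. \<exists>e<2. word_eq (sd_rels m) w (sd_word i e)"
proof -
  let ?s = "(Gen_s, True)" and ?r = "(Gen_r, True)"
  let ?eq = "word_eq (sd_rels m)"
  have cons_s: "\<exists>j. ?eq (?s # sd_word i e) (sd_word j (Suc e))" for i e
    using word_eq_append[OF word_eq_swap_generators[of m i] word_eq.refl[of _ "sd_word 0 e"]]
    by auto
  have cons: "?eq (l # w) (v @ w')" if "?eq [l] v" "?eq w w'" for l v w w'
    using word_eq_append[OF that] by simp
  have "\<exists>i e. ?eq w (sd_word i e)"
  proof (induction w)
    case Nil
    have "?eq [] (sd_word 0 0)" by (simp add: word_eq.refl)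
    then show ?case by blast
  next
    case (Cons l w)
    then obtain i e where w: "?eq w (sd_word i e)" by blast
    consider "l = ?r" | "l = (Gen_r, False)" | "l = ?s" | "l = (Gen_s, False)"
      by (metis (full_types) sd_gen.exhaust surj_pair)
    then show ?case
    proof cases
      case 1
      have "?eq (l # w) (sd_word (Suc i) e)"
        using cons[OF word_eq.refl w, of l] 1 by simp
      then show ?thesis by blast
    next
      case 2
      \<comment> \<open>The inverse of \<open>r\<close>, followed by the trivial word
        \<open>r ^ (2 * m)\<close>, cancels against its first letter.\<close>
      have "?eq ([(Gen_r, False)] @ sd_word (2 * m) 0) ([(Gen_r, False)] @ [])"
        by (intro word_eq_append word_eq.refl sd_rels_word_eq)
      moreover have "?eq ([] @ [(Gen_r, False), (Gen_r, \<not> False)] @ sd_word (2 * m - 1) 0)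
          ([] @ sd_word (2 * m - 1) 0)"
        by (rule word_eq.cancel)
      moreover have "sd_word (2 * m) 0 = ?r # sd_word (2 * m - 1) 0"
        using assms by (cases "2 * m") auto
      ultimately have "?eq [l] (sd_word (2 * m - 1) 0)"
        using 2 by (auto intro: word_eq.trans word_eq.sym)
      from cons[OF this w] have "?eq (l # w) (sd_word (2 * m - 1 + i) e)"
        by (simp add: replicate_add)
      then show ?thesis by blast
    next
      case 3
      then show ?thesis
        using cons[OF word_eq.refl w, of l] cons_s[of i e] by (metis word_eq.trans append_Cons append_Nil)
    next
      case 4
      have "?eq ([(Gen_s, False)] @ sd_word 0 2) ([(Gen_s, False)] @ [])"
        by (intro word_eq_append word_eq.refl sd_rels_word_eq)
      moreover have "?eq ([] @ [(Gen_s, False), (Gen_s, \<not> False)] @ [?s]) ([] @ [?s])"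
        by (rule word_eq.cancel)
      ultimately have "?eq [l] [?s]"
        using 4 by (auto simp: numeral_2_eq_2 intro: word_eq.trans word_eq.sym)
      from cons[OF this w] show ?thesis
        using cons_s[of i e] by (metis word_eq.trans append_Cons append_Nil)
    qed
  qed
  then obtain i e where w: "?eq w (sd_word i e)" by blast
  have "?eq (sd_word i e) (sd_word (i mod (2 * m)) (e mod 2))"
    using sd_rels_word_eq(1,2)[of m] by (intro word_eq_append word_eq_replicate_mod) auto
  with w have "?eq w (sd_word (i mod (2 * m)) (e mod 2))" by (rule word_eq.trans)
  moreover have "i mod (2 * m) < 2 * m" "e mod 2 < 2" using assms by auto
  ultimately show ?thesis by blast
qed

section \<open>Invariants that separate the normal forms\<close>

text \<open>A word with values \<open>t\<close> and \<open>k\<close> of the next two functions acts on the integers modulo \<open>2 * m\<close> as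
  \<open>x \<mapsto> c ^ k * x + t\<close>, where \<open>c = m - 1\<close>: the generator \<open>r\<close> is the translation by 1 and \<open>s\<close> is
  the multiplication by \<open>c\<close>.\<close>

fun translation :: "int \<Rightarrow> sd_gen word \<Rightarrow> int" where
  "translation c [] = 0"
| "translation c ((Gen_r, b) # w) = translation c w + (if b then 1 else - 1)"
| "translation c ((Gen_s, b) # w) = c * translation c w"

fun flips :: "sd_gen word \<Rightarrow> nat" where
  "flips [] = 0"
| "flips ((Gen_r, b) # w) = flips w"
| "flips ((Gen_s, b) # w) = Suc (flips w)"

lemma flips_append: "flips (u @ v) = flips u + flips v"
  by (induction u rule: flips.induct) auto

text \<open>Composition of affine maps, where \<open>u @ v\<close> applies \<open>v\<close>
  first.\<close>

lemma translation_append: "translation c (u @ v) = translation c u + c ^ flips u * translation c v"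
  by (induction c u rule: translation.induct) (auto simp: algebra_simps)

lemma flips_sd_word: "flips (sd_word i e) = e"
proof -
  have "flips (sd_word 0 e) = e" by (induction e) auto
  moreover have "flips (sd_word i 0) = 0" by (induction i) auto
  ultimately show ?thesis by (simp add: flips_append)
qed

lemma translation_sd_word: "translation c (sd_word i e) = int i"
proof -
  have "translation c (sd_word 0 e) = 0" by (induction e) auto
  moreover have "translation c (sd_word i 0) = int i" by (induction i) auto
  ultimately show ?thesis by (simp add: translation_append)
qed

lemma cong_power_mod_2:
  fixes c :: int
  assumes "[c ^ 2 = 1] (mod M)"
  shows "[c ^ k = c ^ (k mod 2)] (mod M)"
proof -
  have "[(c ^ 2) ^ (k div 2) * c ^ (k mod 2) = 1 ^ (k div 2) * c ^ (k mod 2)] (mod M)"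
    using assms by (intro cong_mult cong_pow cong_refl)
  moreover have "(c ^ 2) ^ (k div 2) * c ^ (k mod 2) = c ^ k"
    by (simp flip: power_mult power_add)
  ultimately show ?thesis by simp
qed

text \<open>\<open>(m - 1) ^ 2 - 1 = m * (m - 2)\<close>, and \<open>m - 2\<close> is even. Hence
  \<open>s\<close> and its formal inverse act alike, and a word's multiplier depends only on the
  parity of its flips.\<close>

lemma semidihedral_multiplier_square:
  assumes "4 dvd m"
  shows "[(int m - 1) ^ 2 = 1] (mod 2 * int m)"
proof -
  obtain k where "m = 4 * k" using assms by blast
  then have "(int m - 1) ^ 2 - 1 = 2 * int m * (2 * int k - 1)"
    by (simp add: power2_eq_square algebra_simps)
  then show ?thesis by (simp add: cong_iff_dvd_diff)
qed

lemma word_eq_invariants: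
  fixes m :: nat
  assumes m: "4 dvd m" "m > 0" and "word_eq (sd_rels m) u w"
  shows "[translation (int m - 1) u = translation (int m - 1) w] (mod 2 * int m) \<and>
    flips u mod 2 = flips w mod 2"
proof -
  define c where "c = int m - 1"
  have c2: "[c ^ k = c ^ (k mod 2)] (mod 2 * int m)" for k
    unfolding c_def by (intro cong_power_mod_2 semidihedral_multiplier_square m)
  let ?inv = "\<lambda>u w. [translation c u = translation c w] (mod 2 * int m) \<and> flips u mod 2 = flips w mod 2"
  \<comment> \<open>The translation of \<open>q\<close> is scaled by the multiplier of the word
    before it, so replacing \<open>u\<close> by \<open>w\<close> is harmless only because equal
    parities give congruent multipliers.\<close>
  have in_context: "?inv (p @ u @ q) (p @ w @ q)" if "?inv u w" for p q u w
  proof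
    have "[c ^ flips u = c ^ flips w] (mod 2 * int m)"
      using that c2[of "flips u"] c2[of "flips w"] by (metis cong_sym cong_trans)
    then show "[translation c (p @ u @ q) = translation c (p @ w @ q)] (mod 2 * int m)"
      unfolding translation_append using that by (intro cong_add cong_mult cong_refl) auto
    show "flips (p @ u @ q) mod 2 = flips (p @ w @ q) mod 2"
      using that by (simp add: flips_append) (metis mod_add_cong)
  qed
  have "?inv u w" using assms(3)
  proof induction
    case (refl u)
    then show ?case by (simp add: cong_refl)
  next
    case (sym u w)
    then show ?case by (simp add: cong_sym)
  next
    case (trans u v w)
    then show ?case by (auto intro: cong_trans)
  next
    case (cancel p a b q)
    have "?inv [(a, b), (a, \<not> b)] []" by (cases a) auto
    from in_context[OF this, of p q] show ?case by simp
  next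
    case (relation u w p q)
    then consider "u = sd_word (2 * m) 0" "w = []" | "u = sd_word 0 2" "w = []"
      | "u = [(Gen_s, True), (Gen_r, True), (Gen_s, True)]" "w = sd_word (m - 1) 0"
      by (auto simp: sd_rels_def)
    then have "?inv u w"
    proof cases
      case 1
      then show ?thesis
        unfolding 1 translation_sd_word flips_sd_word by (simp add: cong_iff_dvd_diff)
    next
      case 2
      then show ?thesis unfolding 2 translation_sd_word flips_sd_word by simp
    next
      case 3
      \<comment> \<open>In \<open>s r s\<close> the inner translation by 1 is multiplied by
        \<open>c\<close> once, and the two flips cancel modulo 2.\<close>
      have "translation c u = c" "flips u = 2" unfolding 3(1) by simp_all
      then show ?thesis
        unfolding 3(2) translation_sd_word flips_sd_word using m by (simp add: c_def of_nat_diff)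
    qed
    then show ?case by (rule in_context)
  qed
  then show ?thesis by (simp add: c_def)
qed

text \<open>Completeness follows by reducing both words to normal form: the invariants of
  \<open>sd_word i e\<close> are \<open>i\<close> and \<open>e\<close> themselves, so congruent
  values within the bounds are equal. This solves the word problem and turns commutation into
  arithmetic.\<close>

lemma word_eq_iff_invariants:
  fixes m :: nat
  assumes m: "4 dvd m" "m > 0"
  shows "word_eq (sd_rels m) u w \<longleftrightarrow>
    [translation (int m - 1) u = translation (int m - 1) w] (mod 2 * int m) \<and>
    flips u mod 2 = flips w mod 2" (is "_ \<longleftrightarrow> ?inv u w")
proof
  assume inv: "?inv u w"
  obtain i e where u: "i < 2 * m" "e < 2" "word_eq (sd_rels m) u (sd_word i e)"
    using word_eq_sd_word[OF m(2)] by blast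
  obtain j f where w: "j < 2 * m" "f < 2" "word_eq (sd_rels m) w (sd_word j f)"
    using word_eq_sd_word[OF m(2)] by blast
  note u' = word_eq_invariants[OF m u(3)] and w' = word_eq_invariants[OF m w(3)]
  have "?inv (sd_word i e) (sd_word j f)"
  proof
    show "[translation (int m - 1) (sd_word i e) = translation (int m - 1) (sd_word j f)] (mod 2 * int m)"
      by (rule cong_trans[OF cong_sym[OF conjunct1[OF u']] cong_trans[OF conjunct1[OF inv] conjunct1[OF w']]])
    show "flips (sd_word i e) mod 2 = flips (sd_word j f) mod 2"
      using u' w' inv by simp
  qed
  then have "[int i = int j] (mod 2 * int m)" "e = f"
    unfolding translation_sd_word flips_sd_word using u w by auto
  moreover from this have "i = j"
    using u w by (intro cong_less_modulus_unique_nat[of i j "2 * m"]) (auto simp flip: cong_int_iff)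
  ultimately show "word_eq (sd_rels m) u w"
    using u(3) w(3) by (auto intro: word_eq.trans word_eq.sym)
qed (rule word_eq_invariants[OF m])

section \<open>The commuting graph\<close>

definition sd_elt :: "nat \<Rightarrow> nat \<times> nat \<Rightarrow> sd_gen word set" where
  "sd_elt m = (\<lambda>(i, e). word_class (sd_rels m) (sd_word i e))"

lemma bij_betw_sd_elt:
  assumes m: "4 dvd m" "m > 0"
  shows "bij_betw (sd_elt m) ({..<2 * m} \<times> {..<2}) (carrier (presented_group (sd_rels m)))"
  unfolding bij_betw_def
proof
  show "inj_on (sd_elt m) ({..<2 * m} \<times> {..<2})"
  proof (rule inj_onI, clarsimp)
    fix i e j f :: nat
    assume "i < 2 * m" "e < 2" "j < 2 * m" "f < 2" "sd_elt m (i, e) = sd_elt m (j, f)"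
    then have "[int i = int j] (mod 2 * int m)" "e = f"
      by (auto simp: sd_elt_def word_class_eq_iff word_eq_iff_invariants[OF m]
          translation_sd_word flips_sd_word)
    then show "i = j \<and> e = f"
      using \<open>i < 2 * m\<close> \<open>j < 2 * m\<close> cong_less_modulus_unique_nat[of i j "2 * m"]
      by (auto simp flip: cong_int_iff)
  qed
  show "sd_elt m ` ({..<2 * m} \<times> {..<2}) = carrier (presented_group (sd_rels m))"
  proof
    show "sd_elt m ` ({..<2 * m} \<times> {..<2}) \<subseteq> carrier (presented_group (sd_rels m))"
      by (auto simp: sd_elt_def presented_group_def)
  next
    show "carrier (presented_group (sd_rels m)) \<subseteq> sd_elt m ` ({..<2 * m} \<times> {..<2})"
    proof
      fix x assume "x \<in> carrier (presented_group (sd_rels m))"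
      then obtain w where x: "x = word_class (sd_rels m) w" by (auto simp: presented_group_def)
      obtain i e where "i < 2 * m" "e < 2" "word_eq (sd_rels m) w (sd_word i e)"
        using word_eq_sd_word[OF m(2)] by blast
      then have "x = sd_elt m (i, e)" "(i, e) \<in> {..<2 * m} \<times> {..<2}"
        by (auto simp: x sd_elt_def word_class_eq_iff)
      then show "x \<in> sd_elt m ` ({..<2 * m} \<times> {..<2})" by (rule image_eqI)
    qed
  qed
qed

section \<open>Commutation of normal forms\<close>

definition sd_commute :: "nat \<Rightarrow> nat \<times> nat \<Rightarrow> nat \<times> nat \<Rightarrow> bool" where
  "sd_commute m x y \<longleftrightarrow> sd_elt m x \<otimes>\<^bsub>presented_group (sd_rels m)\<^esub> sd_elt m y =
     sd_elt m y \<otimes>\<^bsub>presented_group (sd_rels m)\<^esub> sd_elt m x"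

text \<open>For \<open>m = 4 * k\<close> one has \<open>m - 2 = 2 * (2 * k - 1)\<close>, and
  \<open>2 * k - 1\<close> is odd and adjacent to \<open>2 * k\<close>, hence coprime to
  \<open>m\<close>. For \<open>m = 2\<close>, that is \<open>n = 3\<close>, the factor
  \<open>m - 2\<close> vanishes and the equivalence fails.\<close>

lemma double_dvd_mult_iff:
  fixes x :: int
  assumes "4 dvd m" "m > 0"
  shows "2 * int m dvd (int m - 2) * x \<longleftrightarrow> int m dvd x"
proof -
  obtain k where k: "m = 4 * k" using assms by blast
  have "coprime (2 * int k - 1) 2" "coprime (2 * int k - 1) (2 * int k)"
    by (simp, rule coprime_diff_one_left)
  then have "coprime (2 * int k - 1) (2 * (2 * int k))"
    by (simp only: coprime_mult_right_iff simp_thms)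
  then have "coprime (int m) (2 * int k - 1)" using k by (simp add: coprime_commute)
  then have "int m dvd (2 * int k - 1) * x \<longleftrightarrow> int m dvd x"
    by (rule coprime_dvd_mult_right_iff)
  moreover have eq: "(int m - 2) * x = 2 * ((2 * int k - 1) * x)" using k by (simp add: algebra_simps)
  ultimately show ?thesis unfolding eq by simp
qed

text \<open>Both products have \<open>e + f\<close> flips, so only their translations can
  differ.\<close>

lemma sd_commute_iff:
  assumes m: "4 dvd m" "m > 0"
  shows "sd_commute m (i, e) (j, f) \<longleftrightarrow>
    2 * int m dvd int i + (int m - 1) ^ e * int j - (int j + (int m - 1) ^ f * int i)"
  by (simp only: sd_commute_def sd_elt_def split presented_group_mult word_class_eq_iff
      \<comment> \<open>The append rules are instantiated to split only between the two normal
        forms, since \<open>sd_word\<close> is itself an append.\<close>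
      word_eq_iff_invariants[OF m] translation_append[of _ "sd_word _ _" "sd_word _ _"] translation_sd_word
      flips_append[of "sd_word _ _" "sd_word _ _"] flips_sd_word cong_iff_dvd_diff add.commute[of e f] simp_thms)

lemma sd_commute_simps:
  assumes m: "4 dvd m" "m > 0"
  shows "sd_commute m (i, 0) (j, 0)"
    and "sd_commute m (i, 0) (j, Suc 0) \<longleftrightarrow> m dvd i"
    and "sd_commute m (i, Suc 0) (j, 0) \<longleftrightarrow> m dvd j"
    and "sd_commute m (i, Suc 0) (j, Suc 0) \<longleftrightarrow> [i = j] (mod m)"
proof -
  \<comment> \<open>Since \<open>(m - 1) - 1 = m - 2\<close>, every nonzero difference of
    translations is a multiple of \<open>m - 2\<close>, the shape that
    \<open>double_dvd_mult_iff\<close> expects.\<close>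
  have rearrange: "int i - (int m - 1) * int i = - ((int m - 2) * int i)"
    "int i + (int m - 1) * int j - (int j + int i) = (int m - 2) * int j"
    "int i + (int m - 1) * int j - (int j + (int m - 1) * int i) = (int m - 2) * (int j - int i)"
    by (simp_all add: algebra_simps)
  show "sd_commute m (i, 0) (j, 0)" by (simp add: sd_commute_iff[OF m])
  show "sd_commute m (i, 0) (j, Suc 0) \<longleftrightarrow> m dvd i"
    using double_dvd_mult_iff[OF m, of "int i"] by (simp add: sd_commute_iff[OF m] rearrange)
  show "sd_commute m (i, Suc 0) (j, 0) \<longleftrightarrow> m dvd j"
    using double_dvd_mult_iff[OF m, of "int j"] by (simp add: sd_commute_iff[OF m] rearrange)
  have "[i = j] (mod m) \<longleftrightarrow> [int j = int i] (mod int m)" by (simp add: cong_int_iff cong_sym_eq)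
  then show "sd_commute m (i, Suc 0) (j, Suc 0) \<longleftrightarrow> [i = j] (mod m)"
    using double_dvd_mult_iff[OF m, of "int j - int i"]
    by (simp add: sd_commute_iff[OF m] rearrange cong_iff_dvd_diff)
qed

section \<open>The clique of rotations and the matching of reflections\<close>

definition sd_rotations :: "nat \<Rightarrow> (nat \<times> nat) set" where
  "sd_rotations m = {i. i < 2 * m \<and> \<not> m dvd i} \<times> {0}"

definition sd_reflections :: "nat \<Rightarrow> (nat \<times> nat) set" where
  "sd_reflections m = {..<2 * m} \<times> {Suc 0}"

definition sd_matching :: "nat \<Rightarrow> (nat \<times> nat) set set" where
  "sd_matching m = (\<lambda>i. {(i, Suc 0), (i + m, Suc 0)}) ` {..<m}"

definition clique_edges :: "'a set \<Rightarrow> 'a set set" where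
  "clique_edges V = {{x, y} | x y. x \<in> V \<and> y \<in> V \<and> x \<noteq> y}"

text \<open>The only multiples of \<open>m\<close> below \<open>2 * m\<close> are 0 and
  \<open>m\<close>, the exponents of the central rotations; this is the 2 subtracted in
  \<open>2 ^ (n - 1) - 2\<close>.\<close>

lemma card_sd_rotations:
  assumes "m > 0"
  shows "card (sd_rotations m) = 2 * m - 2"
proof -
  have "{i. i < 2 * m \<and> \<not> m dvd i} = {..<2 * m} - {0, m}"
  proof -
    have "i = 0 \<or> i = m" if dvd: "i < 2 * m" "m dvd i" for i
    proof -
      obtain k where k: "i = m * k" using dvd(2) by blast
      then have "k < 2" using dvd(1) assms by auto
      then show ?thesis using k by (auto simp: less_2_cases_iff)
    qed
    then show ?thesis by auto
  qed
  moreover have "card ({..<2 * m} - {0, m}) = 2 * m - 2"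
    using assms by (subst card_Diff_subset) auto
  ultimately show ?thesis by (simp add: sd_rotations_def card_cartesian_product)
qed

lemma commuting_graph_sd:
  assumes m: "4 dvd m" "m > 0"
  shows "bij_betw (sd_elt m) (sd_rotations m \<union> sd_reflections m)
      (verts (commuting_graph (presented_group (sd_rels m))))" (is ?verts)
    and "edges (commuting_graph (presented_group (sd_rels m))) =
      (`) (sd_elt m) ` (clique_edges (sd_rotations m) \<union> sd_matching m)" (is ?edges)
proof -
  let ?G = "presented_group (sd_rels m)"
  let ?I = "{..<2 * m} \<times> {..<2::nat}"
  let ?V = "sd_rotations m \<union> sd_reflections m"
  note comm = sd_commute_simps[OF m]
  have m4: "m \<ge> 4" using m by (simp add: dvd_imp_le)
  note bij = bij_betw_sd_elt[OF m]
  have carr: "carrier ?G = sd_elt m ` ?I" and inj: "inj_on (sd_elt m) ?I"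
    using bij by (auto simp: bij_betw_def)
  have VI: "?V \<subseteq> ?I" by (auto simp: sd_rotations_def sd_reflections_def)
  have center: "sd_elt m x \<in> group_center ?G \<longleftrightarrow> x \<notin> ?V" if "x \<in> ?I" for x
  proof -
    have "sd_elt m x \<in> group_center ?G \<longleftrightarrow> (\<forall>y\<in>?I. sd_commute m x y)"
      using that by (auto simp: group_center_def carr sd_commute_def)
    also have "\<dots> \<longleftrightarrow> x \<notin> ?V"
    proof -
      obtain i e where x: "x = (i, e)" by fastforce
      have "e < 2" using that x by simp
      then consider "e = 0" | "e = Suc 0" using less_2_cases by blast
      then show ?thesis
      proof cases
        case 1
        have "(\<forall>y\<in>?I. sd_commute m x y) \<longleftrightarrow> m dvd i"
        proof
          assume "\<forall>y\<in>?I. sd_commute m x y"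
          \<comment> \<open>The reflection \<open>s\<close> alone detects whether a rotation is
            central.\<close>
          then have "sd_commute m x (0, Suc 0)" using m by simp
          then show "m dvd i" by (simp add: x 1 comm)
        next
          assume "m dvd i"
          then show "\<forall>y\<in>?I. sd_commute m x y" by (auto simp: x 1 comm less_2_cases_iff)
        qed
        then show ?thesis using that by (auto simp: x 1 sd_rotations_def sd_reflections_def)
      next
        case 2
        \<comment> \<open>The rotation \<open>r\<close> commutes with no reflection, because
          \<open>m\<close> does not divide 1.\<close>
        have "\<not> sd_commute m x (1, 0)" using m4 by (simp add: x 2 comm)
        moreover have "(1, 0) \<in> ?I" using m4 by simp
        ultimately have "\<not> (\<forall>y\<in>?I. sd_commute m x y)" by blast
        moreover have "x \<in> ?V" using that by (simp add: x 2 sd_reflections_def)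
        ultimately show ?thesis by blast
      qed
    qed
    finally show ?thesis .
  qed
  have "carrier ?G - group_center ?G = sd_elt m ` ?V"
  proof (intro equalityI subsetI)
    fix u assume u: "u \<in> carrier ?G - group_center ?G"
    then obtain x where "x \<in> ?I" "u = sd_elt m x" by (auto simp: carr)
    then show "u \<in> sd_elt m ` ?V" using center[of x] u by blast
  next
    fix u assume "u \<in> sd_elt m ` ?V"
    then obtain x where x: "x \<in> ?V" "u = sd_elt m x" by blast
    then have "x \<in> ?I" using VI by blast
    then show "u \<in> carrier ?G - group_center ?G" using center[of x] x unfolding carr by blast
  qed
  then have verts: "verts (commuting_graph ?G) = sd_elt m ` ?V"
    by (simp add: commuting_graph_def)
  have injV: "inj_on (sd_elt m) ?V" using inj VI by (rule inj_on_subset)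
  with verts show ?verts by (simp add: bij_betw_def)
  have "edges (commuting_graph ?G) =
      (`) (sd_elt m) ` {{x, y} | x y. x \<in> ?V \<and> y \<in> ?V \<and> x \<noteq> y \<and> sd_commute m x y}" (is "_ = _ ` ?E")
  proof -
    have "arcs_ends (commuting_graph ?G) =
        {(u, v). u \<in> sd_elt m ` ?V \<and> v \<in> sd_elt m ` ?V \<and> u \<noteq> v \<and> u \<otimes>\<^bsub>?G\<^esub> v = v \<otimes>\<^bsub>?G\<^esub> u}"
      using verts by (auto simp: arcs_ends_conv commuting_graph_def)
    also have "\<dots> = {(sd_elt m x, sd_elt m y) | x y. x \<in> ?V \<and> y \<in> ?V \<and> x \<noteq> y \<and> sd_commute m x y}"
      using inj_on_eq_iff[OF injV] unfolding sd_commute_def by blast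
    finally show ?thesis
      by (rule edges_eq_image)
  qed
  also have "?E = clique_edges (sd_rotations m) \<union> sd_matching m"
  proof (intro equalityI subsetI)
    fix a assume "a \<in> ?E"
    then obtain i e j f where a: "a = {(i, e), (j, f)}" "(i, e) \<in> ?V" "(j, f) \<in> ?V"
      "(i, e) \<noteq> (j, f)" "sd_commute m (i, e) (j, f)" by auto
    \<comment> \<open>A mixed pair would require \<open>m\<close> to divide the exponent of the
      rotation, and such rotations are central.\<close>
    then consider "e = 0" "f = 0" | "e = Suc 0" "f = Suc 0"
      by (auto simp: sd_rotations_def sd_reflections_def comm)
    then show "a \<in> clique_edges (sd_rotations m) \<union> sd_matching m"
    proof cases
      case 1
      then show ?thesis using a by (auto simp: clique_edges_def sd_rotations_def sd_reflections_def)
    next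
      case 2
      \<comment> \<open>The difference is a positive multiple of \<open>m\<close> below
        \<open>2 * m\<close>, hence \<open>m\<close> itself.\<close>
      have matched: "i' < m \<and> j' = i' + m" if "i' < j'" "j' < 2 * m" "[i' = j'] (mod m)" for i' j'
      proof -
        have "m dvd j' - i'" using that by (metis cong_altdef_nat cong_sym less_imp_le)
        then obtain k where k: "j' - i' = m * k" by blast
        have "k > 0" using k that(1) by (intro Nat.gr0I) simp
        moreover have "m * k < m * 2" using k that by linarith
        ultimately have "k = 1" by simp
        then show ?thesis using k that by auto
      qed
      have "[i = j] (mod m)" "i < 2 * m" "j < 2 * m" "i \<noteq> j"
        using a 2 by (auto simp: comm sd_rotations_def sd_reflections_def)
      then have "(i < m \<and> j = i + m) \<or> (j < m \<and> i = j + m)"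
        using matched[of i j] matched[of j i] by (auto simp: cong_sym_eq neq_iff)
      then show ?thesis using a(1) 2 by (auto simp: sd_matching_def insert_commute)
    qed
  next
    fix a assume "a \<in> clique_edges (sd_rotations m) \<union> sd_matching m"
    then show "a \<in> ?E"
    proof
      assume "a \<in> clique_edges (sd_rotations m)"
      then obtain x y where "a = {x, y}" "x \<in> sd_rotations m" "y \<in> sd_rotations m" "x \<noteq> y"
        by (auto simp: clique_edges_def)
      moreover from this have "sd_commute m x y" by (auto simp: sd_rotations_def comm)
      ultimately show ?thesis by blast
    next
      assume "a \<in> sd_matching m"
      then obtain i where i: "i < m" "a = {(i, Suc 0), (i + m, Suc 0)}"
        unfolding sd_matching_def by blast
      moreover have "sd_commute m (i, Suc 0) (i + m, Suc 0)" by (simp add: comm cong_def)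
      moreover have "(i, Suc 0) \<in> ?V" "(i + m, Suc 0) \<in> ?V" "(i, Suc 0) \<noteq> (i + m, Suc 0)"
        using i m by (auto simp: sd_reflections_def)
      ultimately show ?thesis by blast
    qed
  qed
  finally show ?edges .
qed

text \<open>In a complete graph every bijection of vertices preserves edges, so \<open>K\<close> may
  be relabelled by any set of the right size, here the rotations.\<close>

lemma embeddable_in_complete_digraph_iff:
  assumes K: "K\<^bsub>card V\<^esub> K" and V: "finite V"
  shows "embeddable_in K S \<longleftrightarrow> (\<exists>p \<gamma>. drawing p \<gamma> V (clique_edges V) S)"
proof -
  interpret graph K using K by (simp add: complete_digraph_def)
  have "card V = card (verts K)" using K by (simp add: complete_digraph_def)
  then obtain f where f: "bij_betw f V (verts K)"
    using V finite_verts finite_same_card_bij by blast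
  have im: "f ` V = verts K" and inj: "inj_on f V" using f by (auto simp: bij_betw_def)
  have "arcs_ends K = {(u, v). u \<in> f ` V \<and> v \<in> f ` V \<and> u \<noteq> v}"
    using K by (auto simp: complete_digraph_def im)
  also have "\<dots> = {(f x, f y) | x y. x \<in> V \<and> y \<in> V \<and> x \<noteq> y}"
    using inj_on_eq_iff[OF inj] by blast
  finally have "edges K = (`) f ` clique_edges V"
    unfolding clique_edges_def by (rule edges_eq_image)
  then show ?thesis
    using f by (intro embeddable_in_iff_drawing_iso) (auto simp: clique_edges_def)
qed

text \<open>Because the equivalence holds for each \<open>g\<close> separately, the two
  \<open>LEAST\<close> terms defining the genera range over the same predicate.\<close>

lemma embeddable_commuting_graph_iff_complete:
  assumes m: "4 dvd m" "m > 0" and K: "K\<^bsub>2 * m - 2\<^esub> K"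
  shows "embeddable_in (commuting_graph (presented_group (sd_rels m))) (sphere_with_handles g) \<longleftrightarrow>
    embeddable_in K (sphere_with_handles g)"
proof -
  let ?V = "sd_rotations m" and ?B = "sd_reflections m" and ?M = "sd_matching m"
  have finV: "finite ?V" and finB: "finite ?B"
    by (simp_all add: sd_rotations_def sd_reflections_def)
  have MB: "e \<subseteq> ?B" if "e \<in> ?M" for e using that by (auto simp: sd_matching_def sd_reflections_def)
  have "embeddable_in (commuting_graph (presented_group (sd_rels m))) (sphere_with_handles g) \<longleftrightarrow>
      (\<exists>p \<gamma>. drawing p \<gamma> (?V \<union> ?B) (clique_edges ?V \<union> ?M) (sphere_with_handles g))"
    by (rule embeddable_in_iff_drawing_iso[OF commuting_graph_sd[OF m]])
      (use MB in \<open>auto simp: clique_edges_def\<close>)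
  also have "\<dots> \<longleftrightarrow> (\<exists>p \<gamma>. drawing p \<gamma> ?V (clique_edges ?V) (sphere_with_handles g))"
  proof
    assume "\<exists>p \<gamma>. drawing p \<gamma> (?V \<union> ?B) (clique_edges ?V \<union> ?M) (sphere_with_handles g)"
    then obtain p \<gamma> where "drawing p \<gamma> (?V \<union> ?B) (clique_edges ?V \<union> ?M) (sphere_with_handles g)"
      by blast
    then have "drawing (p \<circ> id) (\<lambda>e. \<gamma> (id ` e)) ?V (clique_edges ?V) (sphere_with_handles g)"
      by (rule drawing_pullback) (auto simp: clique_edges_def)
    then show "\<exists>p \<gamma>. drawing p \<gamma> ?V (clique_edges ?V) (sphere_with_handles g)" by blast
  next
    \<comment> \<open>For \<open>i < m\<close> the partners \<open>i\<close> and
      \<open>i + m\<close> share the remainder \<open>i\<close> and have quotients 0 and 1, so they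
      are numbered \<open>2 * i\<close> and \<open>2 * i + 1\<close>.\<close>
    define h :: "nat \<times> nat \<Rightarrow> nat" where "h = (\<lambda>(i, e). 2 * (i mod m) + i div m)"
    have "inj_on h ?B"
    proof (rule inj_onI)
      fix x y assume "x \<in> ?B" "y \<in> ?B" and eq: "h x = h y"
      then obtain i j where x: "x = (i, Suc 0)" "i < 2 * m" and y: "y = (j, Suc 0)" "j < 2 * m"
        by (auto simp: sd_reflections_def)
      \<comment> \<open>As the quotient is a single binary digit, the value of \<open>h\<close>
        determines both quotient and remainder.\<close>
      have "i div m < 2" "j div m < 2" using x y m by (auto simp: less_mult_imp_div_less mult.commute)
      moreover have "2 * (i mod m) + i div m = 2 * (j mod m) + j div m" using eq by (simp add: h_def x y)
      moreover have "a = c \<and> b = d" if "b < 2" "d < 2" "2 * a + b = 2 * c + d" for a b c d :: nat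
        using that by presburger
      ultimately have "i div m = j div m" "i mod m = j mod m" by blast+
      then show "x = y" using x y by (metis div_mult_mod_eq)
    qed
    moreover have "\<exists>i. h ` e = {2 * i, 2 * i + 1}" if e: "e \<in> ?M" for e
    proof -
      obtain i where "i < m" "e = {(i, Suc 0), (i + m, Suc 0)}"
        using e unfolding sd_matching_def by blast
      then have "h ` e = {2 * i, 2 * i + 1}" using m by (simp add: h_def)
      then show ?thesis by blast
    qed
    moreover assume "\<exists>p \<gamma>. drawing p \<gamma> ?V (clique_edges ?V) (sphere_with_handles g)"
    moreover have "finite (clique_edges ?V)"
      using finV by (rule finite_subset[OF _ finite_Pow_iff[THEN iffD2], rotated]) (auto simp: clique_edges_def)
    moreover have "?V \<inter> ?B = {}" by (auto simp: sd_rotations_def sd_reflections_def)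
    moreover have "clique_edges ?V \<subseteq> Pow ?V - {{}}" by (auto simp: clique_edges_def)
    ultimately show "\<exists>p \<gamma>. drawing p \<gamma> (?V \<union> ?B) (clique_edges ?V \<union> ?M) (sphere_with_handles g)"
      using drawing_add_matching[of _ _ ?V "clique_edges ?V" g ?B h ?M] finV finB MB by blast
  qed
  also have "\<dots> \<longleftrightarrow> embeddable_in K (sphere_with_handles g)"
  proof -
    have "K\<^bsub>card ?V\<^esub> K" using K card_sd_rotations[OF m(2)] by simp
    then show ?thesis by (rule embeddable_in_complete_digraph_iff[OF _ finV, symmetric])
  qed
  finally show ?thesis .
qed

theorem proposition4p3:
  fixes n :: nat and K :: "('v, 'e) pre_digraph"
  assumes "n \<ge> 4"
    and "K\<^bsub>2 ^ (n - 1) - 2\<^esub> K"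
  shows "genus (commuting_graph (semidihedral n)) = genus K"
proof -
  let ?m = "2 ^ (n - 2) :: nat"
  have "(2::nat) ^ 2 dvd ?m" using assms(1) by (intro le_imp_power_dvd) simp
  then have m: "4 dvd ?m" "?m > 0" by simp_all
  have "n - 1 = Suc (n - 2)" using assms(1) by simp
  then have "(2::nat) ^ (n - 1) = 2 * ?m" by (simp only: power_Suc)
  then have K: "K\<^bsub>2 * ?m - 2\<^esub> K" using assms(2) by simp
  have "semidihedral n = presented_group (sd_rels ?m)"
    using assms(1) by (intro semidihedral_eq_presented_group) simp
  then show ?thesis
    using embeddable_commuting_graph_iff_complete[OF m K] by (simp add: genus_def)
qed

end
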